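(* For every instance $(G,Q)$ of the QCCP we have $v^{GL}_{LBB}=v_{GL}$.
   Context: An instance of the QCCP (quadratic cycle cover problem, minimize $x^TQx$ over $x\in X$) is a pair $(G,Q)$ with $G=(N,A)$ a directed graph, $A\subseteq N\times N$, $N=\{1,\dots,n\}$, $|A|=m$, and $Q\in\mathbb{R}^{m\times m}$ indexed by arcs, with $Q_{ef}=0$ if the starting node of $f$ is not the ending node of $e$ (except that linear arc costs may be placed on the diagonal). For an arc $e$, $e^+$ is its starting node and $e^-$ its ending node. For $i\in N$, $\delta^+(i)$ and $\delta^-(i)$ are the sets of arcs leaving and entering $i$. The set of cycle covers is $$X=\Big\{x\in\{0,1\}^m : \sum_{e\in\delta^+(i)}x_e=\sum_{e\in\delta^-(i)}x_e=1\ \ \forall i\in N\Big\}.$$ Gilmore-Lawler type bound: for $e\in A$ let $Q_{e,:}$ be the $e$th row of $Q$ and $z_e:=\min\{Q_{e,:}x : x\in X,\ x_e=1\}$, with $z_e:=0$ if this feasible set is empty; let $z=(z_e)_{e\in A}$ and $v_{GL}:=\min\{z^Tx : x\in X\}$ (the minimum over an empty set is $+\infty$). Linearization based bound: let $U,V\in\mathbb{R}^{n\times m}$ be given by $U_{ie}=1$ if $i=e^+$ and $0$ otherwise, and $V_{ie}=1$ if $i=e^-$ and $0$ otherwise. Let $S_{GL}(Q)$ be the set of matrices $\hat Q\in\mathbb{R}^{m\times m}$ with $Q-\hat Q\ge 0$ elementwise for which there exist $B,C\in\mathbb{R}^{m\times n}$, $t\in\mathbb{R}^m$ with $\hat Q_{ef}=B_{e,f^+}+C_{e,f^-}$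 for $e\ne f$ and $\hat Q_{ee}=B_{e,e^+}+C_{e,e^-}+t_e$ for all $e\in A$. Let $$\tau_{GL}(Q)=\{\hat p\in\mathbb{R}^m : \exists\,\hat Q\in S_{GL}(Q)\text{ with } x^T\hat p=x^T\hat Qx\ \text{ for all }x\in X\},$$ $$v^{GL}_{LBB}=\max_{y\in\mathbb{R}^{2n},\ \hat p\in\mathbb{R}^m}\{\mathbf{1}_{2n}^Ty : [U^T,V^T]y\le\hat p,\ \hat p\in\tau_{GL}(Q)\},$$ where $\mathbf{1}_{2n}$ is the all-ones vector (the value is $+\infty$ if unbounded). *)

theory Defs
  imports Complex_Main "HOL-Library.FuncSet" "HOL-Library.Extended_Real"
begin

(* Nodes are 1..n and an arc e = (i, j) starts at i = fst e and ends at j = snd e.  Vectors and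
   matrices indexed by nodes or arcs are total functions of which only the entries with indices
   in the relevant index set ({1..n}, {1..2 * n} or A) are ever constrained or used. *)

type_synonym arc = "nat \<times> nat"

definition qccp_instance :: "nat \<Rightarrow> arc set \<Rightarrow> (arc \<Rightarrow> arc \<Rightarrow> real) \<Rightarrow> bool" where
  "qccp_instance n A Q \<longleftrightarrow>
     A \<subseteq> {1..n} \<times> {1..n} \<and>
     (\<forall>e\<in>A. \<forall>f\<in>A. e \<noteq> f \<longrightarrow> fst f \<noteq> snd e \<longrightarrow> Q e f = 0)"

definition arcs_out :: "arc set \<Rightarrow> nat \<Rightarrow> arc set" where
  "arcs_out A i = {e \<in> A. fst e = i}"

definition arcs_in :: "arc set \<Rightarrow> nat \<Rightarrow> arc set" where
  "arcs_in A i = {e \<in> A. snd e = i}"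

definition cycle_covers :: "nat \<Rightarrow> arc set \<Rightarrow> (arc \<Rightarrow> real) set" where
  "cycle_covers n A =
     {x \<in> A \<rightarrow>\<^sub>E {0, 1}.
        \<forall>i\<in>{1..n}. (\<Sum>e\<in>arcs_out A i. x e) = 1 \<and> (\<Sum>e\<in>arcs_in A i. x e) = 1}"

definition dot :: "arc set \<Rightarrow> (arc \<Rightarrow> real) \<Rightarrow> (arc \<Rightarrow> real) \<Rightarrow> real" where
  "dot A p x = (\<Sum>e\<in>A. p e * x e)"

definition quad :: "arc set \<Rightarrow> (arc \<Rightarrow> arc \<Rightarrow> real) \<Rightarrow> (arc \<Rightarrow> real) \<Rightarrow> real" where
  "quad A Q x = (\<Sum>e\<in>A. \<Sum>f\<in>A. x e * Q e f * x f)"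

definition gl_cost :: "nat \<Rightarrow> arc set \<Rightarrow> (arc \<Rightarrow> arc \<Rightarrow> real) \<Rightarrow> arc \<Rightarrow> real" where
  "gl_cost n A Q e =
     (let X\<^sub>e = {x \<in> cycle_covers n A. x e = 1}
      in if X\<^sub>e = {} then 0 else Min ((\<lambda>x. dot A (Q e) x) ` X\<^sub>e))"

definition v_GL :: "nat \<Rightarrow> arc set \<Rightarrow> (arc \<Rightarrow> arc \<Rightarrow> real) \<Rightarrow> ereal" where
  "v_GL n A Q =
     (if cycle_covers n A = {} then \<infinity>
      else ereal (Min ((\<lambda>x. dot A (gl_cost n A Q) x) ` cycle_covers n A)))"

definition U_mat :: "nat \<Rightarrow> arc \<Rightarrow> real" where
  "U_mat i e = (if i = fst e then 1 else 0)"

definition V_mat :: "nat \<Rightarrow> arc \<Rightarrow> real" where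
  "V_mat i e = (if i = snd e then 1 else 0)"

definition S_GL :: "arc set \<Rightarrow> (arc \<Rightarrow> arc \<Rightarrow> real) \<Rightarrow> (arc \<Rightarrow> arc \<Rightarrow> real) set" where
  "S_GL A Q =
     {Qh. (\<forall>e\<in>A. \<forall>f\<in>A. Q e f - Qh e f \<ge> 0) \<and>
          (\<exists>(B :: arc \<Rightarrow> nat \<Rightarrow> real) (C :: arc \<Rightarrow> nat \<Rightarrow> real) (t :: arc \<Rightarrow> real).
             (\<forall>e\<in>A. \<forall>f\<in>A. e \<noteq> f \<longrightarrow> Qh e f = B e (fst f) + C e (snd f)) \<and>
             (\<forall>e\<in>A. Qh e e = B e (fst e) + C e (snd e) + t e))}"

definition tau_GL :: "nat \<Rightarrow> arc set \<Rightarrow> (arc \<Rightarrow> arc \<Rightarrow> real) \<Rightarrow> (arc \<Rightarrow> real) set" where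
  "tau_GL n A Q = {p. \<exists>Qh\<in>S_GL A Q. \<forall>x\<in>cycle_covers n A. dot A p x = quad A Qh x}"

(* The objective values attained on the feasible region; the first n entries of y multiply the
   columns of the transpose of U, the last n those of the transpose of V. *)
definition lbb_values :: "nat \<Rightarrow> arc set \<Rightarrow> (arc \<Rightarrow> arc \<Rightarrow> real) \<Rightarrow> real set" where
  "lbb_values n A Q =
     {\<Sum>i\<in>{1..2 * n}. y i | (y :: nat \<Rightarrow> real) p.
        p \<in> tau_GL n A Q \<and>
        (\<forall>e\<in>A. (\<Sum>i\<in>{1..n}. U_mat i e * y i) + (\<Sum>i\<in>{1..n}. V_mat i e * y (n + i)) \<le> p e)}"

(* A genuine maximum: GREATEST is left unspecified if a bounded set does not attain its
   supremum. *)
definition max_value :: "real set \<Rightarrow> ereal" where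
  "max_value S =
     (if S = {} then -\<infinity>
      else if bdd_above S then ereal (GREATEST v. v \<in> S)
      else \<infinity>)"

definition v_LBB_GL :: "nat \<Rightarrow> arc set \<Rightarrow> (arc \<Rightarrow> arc \<Rightarrow> real) \<Rightarrow> ereal" where
  "v_LBB_GL n A Q = max_value (lbb_values n A Q)"

end

theory Submission
  imports Defs "HOL-Combinatorics.Cycles"
begin

text \<open>
  Cycle covers are exactly the perfect matchings of the bipartite graph that has a tail copy and a
  head copy of each node and whose edges are the arcs, so minimizing a linear cost over them is an assignment
  problem.  The theorem is strong duality for assignment problems, used twice.

  Suppose first that a cycle cover exists.  If \<open>Qh \<in> S_GL A Q\<close>, then a row of \<open>Qh\<close> is
  a sum of node potentials plus a constant for its own arc \<open>e\<close>, hence takes the same value on all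
  covers through \<open>e\<close>.  As \<open>Qh \<le> Q\<close>, this value is at most \<open>gl_cost n A Q e\<close>; summing
  over the arcs of a cover gives \<open>quad A Qh x \<le> dot A (gl_cost n A Q) x\<close>
  (\<open>S_GL_quad_le\<close>), and weak duality turns this into the bound of \<open>v_LBB_GL\<close> by
  \<open>v_GL\<close>.  Conversely, strong duality for the problem that defines \<open>gl_cost n A Q e\<close> yields
  a row for which the inequality is tight (\<open>optimal_linearizable_row\<close>).  With such rows
  \<open>gl_cost n A Q\<close> itself lies in \<open>tau_GL n A Q\<close>, and strong duality for this cost vector
  produces a feasible \<open>y\<close> of value \<open>v_GL\<close>.

  If there is no cycle cover, the requirement on \<open>x\<close> in \<open>tau_GL n A Q\<close> is
  vacuous; as \<open>S_GL A Q\<close> is nonempty, every vector belongs to \<open>tau_GL n A Q\<close> and the linearization bound is unbounded, in agreement with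
  \<open>v_GL n A Q = \<infinity>\<close>.

  Strong duality itself (\<open>cycle_cover_duality\<close>) has a combinatorial proof.  Fix an optimal
  assignment and let \<open>w i k\<close> be the extra cost incurred when \<open>i\<close> takes over the partner of
  \<open>k\<close>.  Optimality says that no cycle of such exchanges has negative weight, so shortest-walk
  distances are finite, and they are dual variables that are tight on the optimal assignment.
\<close>

section \<open>Potentials for weights without negative cycles\<close>

fun walk_weight :: "('a \<Rightarrow> 'a \<Rightarrow> real) \<Rightarrow> 'a list \<Rightarrow> real" where
  "walk_weight w (x # y # zs) = w x y + walk_weight w (y # zs)"
| "walk_weight w _ = 0"

text \<open>
  Walks are given by their vertex lists, so two walks are joined by identifying the vertex
  \<open>x\<close> at which they meet.
\<close>
lemma walk_weight_split:
  "walk_weight w (xs @ x # ys) = walk_weight w (xs @ [x]) + walk_weight w (x # ys)"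
proof (induction xs)
  case (Cons a xs)
  then show ?case by (cases xs) auto
qed simp

lemma walk_weight_sum_list:
  "walk_weight w (x # xs @ [y]) = sum_list (map2 w (x # xs) (xs @ [y]))"
  by (induction xs arbitrary: x) auto

text \<open>
  A closed walk without repeated vertices is a cyclic permutation of its vertices; the fixed points
  of that permutation contribute only zero diagonal weights.
\<close>
lemma cycle_weight_nonneg:
  assumes "finite S" "\<And>i. w i i = 0"
    and perm: "\<And>p. p permutes S \<Longrightarrow> 0 \<le> (\<Sum>i\<in>S. w i (p i))"
    and cs: "distinct (x # xs)" "set (x # xs) \<subseteq> S"
  shows "0 \<le> walk_weight w (x # xs @ [x])"
proof -
  let ?cs = "x # xs"
  let ?p = "cycle_of_list ?cs"
  have map2_map: "map2 w ys (map q ys) = map (\<lambda>i. w i (q i)) ys" for ys q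
    by (induction ys) auto
  have p: "?p permutes S"
    using cycle_permutes[of ?cs] cs(2) by (rule permutes_subset)
  have fix_out: "?p i = i" if "i \<notin> set ?cs" for i
    using id_outside_supp[OF that] .
  have rot: "map ?p ?cs = rotate1 ?cs"
    using cyclic_rotation[of ?cs 1] cs(1) by simp
  have "walk_weight w (x # xs @ [x]) = sum_list (map2 w ?cs (map ?p ?cs))"
    unfolding rot by (simp only: walk_weight_sum_list rotate1.simps)
  also have "\<dots> = sum_list (map (\<lambda>i. w i (?p i)) ?cs)"
    by (rule arg_cong[OF map2_map])
  also have "\<dots> = (\<Sum>i\<in>set ?cs. w i (?p i))"
    using cs(1) by (subst sum_list_distinct_conv_sum_set) auto
  also have "\<dots> = (\<Sum>i\<in>S. w i (?p i))"
    using assms(1,2) cs(2) fix_out by (intro sum.mono_neutral_left) (auto simp del: cycle_of_list.simps)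
  finally show ?thesis using perm[OF p] by simp
qed

text \<open>
  A closed walk that visits a vertex \<open>y\<close> twice is the union of two shorter closed walks,
  one of them from \<open>y\<close> to \<open>y\<close>; repeating this leaves simple cycles.
\<close>
lemma closed_walk_weight_nonneg:
  assumes S: "finite S" and refl: "\<And>i. w i i = 0"
    and perm: "\<And>p. p permutes S \<Longrightarrow> 0 \<le> (\<Sum>i\<in>S. w i (p i))"
    and "set (x # xs) \<subseteq> S"
  shows "0 \<le> walk_weight w (x # xs @ [x])"
  using assms(4)
proof (induction "length xs" arbitrary: x xs rule: less_induct)
  case less
  show ?case
  proof (cases "distinct (x # xs)")
    case True
    show ?thesis
      by (rule cycle_weight_nonneg[where w = w, OF S refl perm True less.prems])
  next
    case False
    then obtain as y bs cs where dec: "x # xs = as @ [y] @ bs @ [y] @ cs"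
      using not_distinct_decomp[of "x # xs"] by blast
    have 1: "0 \<le> walk_weight w (y # bs @ [y])"
    proof (rule less.hyps)
      have "length (x # xs) = length (as @ [y] @ bs @ [y] @ cs)" using dec by simp
      then show "length bs < length xs" by simp
      show "set (y # bs) \<subseteq> S" using less.prems unfolding dec by simp
    qed
    have 2: "0 \<le> walk_weight w (as @ y # cs @ [x])"
    proof (cases as)
      case Nil
      have "0 \<le> walk_weight w (x # cs @ [x])"
      proof (rule less.hyps)
        show "length cs < length xs" "set (x # cs) \<subseteq> S"
          using dec less.prems Nil by auto
      qed
      then show ?thesis using dec Nil by simp
    next
      case (Cons a as')
      have "0 \<le> walk_weight w (x # (as' @ y # cs) @ [x])"
      proof (rule less.hyps)
        show "length (as' @ y # cs) < length xs" "set (x # as' @ y # cs) \<subseteq> S"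
          using dec less.prems Cons by auto
      qed
      then show ?thesis using dec Cons by simp
    qed
    have "walk_weight w (x # xs @ [x]) = walk_weight w (as @ y # (bs @ y # (cs @ [x])))"
      using dec by (metis append.assoc append_Cons append_Nil)
    also have "\<dots> = walk_weight w (as @ [y]) + walk_weight w ((y # bs) @ y # (cs @ [x]))"
      by (subst walk_weight_split) simp
    also have "walk_weight w ((y # bs) @ y # (cs @ [x]))
        = walk_weight w (y # bs @ [y]) + walk_weight w (y # cs @ [x])"
      by (subst walk_weight_split) simp
    also have "walk_weight w (as @ [y]) + (walk_weight w (y # bs @ [y]) + walk_weight w (y # cs @ [x]))
        = walk_weight w (y # bs @ [y]) + walk_weight w (as @ y # cs @ [x])"
      using walk_weight_split[of w as y "cs @ [x]"] by simp
    finally show ?thesis using 1 2 by linarith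
  qed
qed

text \<open>
  The potential is the distance to a fixed vertex \<open>r\<close>, the infimum of the weights of all walks
  from \<open>i\<close> to \<open>r\<close>.  It is finite because closing such a walk by the step from
  \<open>r\<close> back to \<open>i\<close> gives a closed walk, which has nonnegative weight.
\<close>
lemma potential_exists:
  fixes w :: "'a \<Rightarrow> 'a \<Rightarrow> real"
  assumes S: "finite S" and refl: "\<And>i. w i i = 0"
    and perm: "\<And>p. p permutes S \<Longrightarrow> 0 \<le> (\<Sum>i\<in>S. w i (p i))"
  obtains u where "\<And>i k. i \<in> S \<Longrightarrow> k \<in> S \<Longrightarrow> u i \<le> w i k + u k"
proof (cases "S = {}")
  case False
  then obtain r where r: "r \<in> S" by blast
  define W where "W i = (\<lambda>zs. walk_weight w (i # zs @ [r])) ` lists S" for i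
  have ne: "W i \<noteq> {}" for i
    unfolding W_def by (metis image_is_empty empty_iff lists.Nil)
  have bdd: "bdd_below (W i)" if i: "i \<in> S" for i
  proof (rule bdd_belowI)
    fix a assume "a \<in> W i"
    then obtain zs where zs: "zs \<in> lists S" and a: "a = walk_weight w (i # zs @ [r])"
      unfolding W_def by blast
    have "0 \<le> walk_weight w (i # (zs @ [r]) @ [i])"
      by (rule closed_walk_weight_nonneg[where w = w, OF S refl perm]) (use zs r i in auto)
    also have "\<dots> = walk_weight w ((i # zs) @ r # [i])" by simp
    also have "\<dots> = a + w r i"
      unfolding a by (subst walk_weight_split) simp
    finally show "- w r i \<le> a" by simp
  qed
  show ?thesis
  proof (rule that[of "\<lambda>i. Inf (W i)"])
    fix i k assume i: "i \<in> S" and k: "k \<in> S"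
    have "Inf (W i) - w i k \<le> Inf (W k)"
    proof (rule cInf_greatest[OF ne])
      fix a assume "a \<in> W k"
      then obtain zs where zs: "zs \<in> lists S" and a: "a = walk_weight w (k # zs @ [r])"
        unfolding W_def by blast
      have "w i k + a = walk_weight w (i # (k # zs) @ [r])" unfolding a by simp
      then have "w i k + a \<in> W i"
        unfolding W_def by (rule image_eqI) (use zs k in simp)
      from cInf_lower[OF this bdd[OF i]] show "Inf (W i) - w i k \<le> a" by simp
    qed
    then show "Inf (W i) \<le> w i k + Inf (W k)" by simp
  qed
qed (use that in blast)

section \<open>Strong duality for the assignment problem\<close>

text \<open>
  Composing the optimal \<open>s\<close> with a permutation \<open>p\<close> changes its cost by the total
  weight of the exchanges in \<open>p\<close>.  A potential \<open>u\<close> for the exchange weights, together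
  with the \<open>v\<close> that makes every pair \<open>(k, s k)\<close> tight, is therefore dual feasible and
  has the same value as \<open>s\<close>.
\<close>
lemma assignment_duality:
  fixes c :: "'a \<Rightarrow> 'a \<Rightarrow> real"
  assumes S: "finite S" and s: "s permutes S"
    and opt: "\<And>p. p permutes S \<Longrightarrow> (\<Sum>i\<in>S. c i (s i)) \<le> (\<Sum>i\<in>S. c i (p i))"
  obtains u v where "\<And>i j. i \<in> S \<Longrightarrow> j \<in> S \<Longrightarrow> u i + v j \<le> c i j"
    and "sum u S + sum v S = (\<Sum>i\<in>S. c i (s i))"
proof -
  define w where "w i k = c i (s k) - c k (s k)" for i k
  have "0 \<le> (\<Sum>i\<in>S. w i (p i))" if p: "p permutes S" for p
  proof -
    have "(\<Sum>i\<in>S. w i (p i)) = (\<Sum>i\<in>S. c i ((s \<circ> p) i)) - (\<Sum>i\<in>S. c (p i) (s (p i)))"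
      by (simp add: w_def sum_subtractf)
    also have "(\<Sum>i\<in>S. c (p i) (s (p i))) = (\<Sum>i\<in>S. c i (s i))"
      using sum.permute[OF p, of "\<lambda>i. c i (s i)"] by (simp add: o_def)
    finally show ?thesis
      using opt[OF permutes_compose[OF p s]] by simp
  qed
  then obtain u where u: "\<And>i k. i \<in> S \<Longrightarrow> k \<in> S \<Longrightarrow> u i \<le> w i k + u k"
    using potential_exists[OF S, of w] by (auto simp: w_def)
  define v where "v j = (let k = inv s j in c k (s k) - u k)" for j
  have v: "v (s k) = c k (s k) - u k" for k
    using permutes_inverses(2)[OF s] by (simp add: v_def)
  show ?thesis
  proof (rule that[of u v])
    fix i j assume i: "i \<in> S" and j: "j \<in> S"
    obtain k where k: "k \<in> S" "j = s k"
      using j permutes_image[OF s] by blast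
    show "u i + v j \<le> c i j" using u[OF i k(1)] unfolding k(2) v w_def by simp
  next
    have "sum v S = (\<Sum>k\<in>S. v (s k))"
      using sum.permute[OF s, of v] by (simp add: o_def)
    then show "sum u S + sum v S = (\<Sum>i\<in>S. c i (s i))"
      by (simp add: v sum_subtractf)
  qed
qed

text \<open>
  The constraints of the linear programming dual of an assignment problem whose bipartite graph
  need not be complete.
\<close>
definition dual_feasible ::
    "('a \<times> 'a) set \<Rightarrow> ('a \<times> 'a \<Rightarrow> real) \<Rightarrow> ('a \<Rightarrow> real) \<Rightarrow> ('a \<Rightarrow> real) \<Rightarrow> bool" where
  "dual_feasible A c u v \<longleftrightarrow> (\<forall>e\<in>A. u (fst e) + v (snd e) \<le> c e)"

text \<open>
  Reduction to the complete graph: missing pairs get a price \<open>K\<close> so high that using one of them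
  is never cheaper than an assignment within \<open>A\<close>.
\<close>
lemma sparse_assignment_duality:
  fixes c :: "'a \<times> 'a \<Rightarrow> real"
  assumes S: "finite S" and A: "A \<subseteq> S \<times> S" and ex: "p0 permutes S" "\<And>i. i \<in> S \<Longrightarrow> (i, p0 i) \<in> A"
  obtains s u v where "s permutes S" and "\<forall>i\<in>S. (i, s i) \<in> A"
    and "dual_feasible A c u v" and "sum u S + sum v S = (\<Sum>i\<in>S. c (i, s i))"
proof -
  define P where "P = {p. p permutes S}"
  define PA where "PA = {p \<in> P. \<forall>i\<in>S. (i, p i) \<in> A}"
  define cost where "cost p = (\<Sum>i\<in>S. c (i, p i))" for p
  define g where "g e = (if e \<in> A then c e else 0)" for e
  define gcost where "gcost p = (\<Sum>i\<in>S. g (i, p i))" for p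
  have finP: "finite P" unfolding P_def by (rule finite_permutations[OF S])
  then have finPA: "finite PA" unfolding PA_def by simp
  have "PA \<noteq> {}" using ex unfolding PA_def P_def by blast
  then have "Min (cost ` PA) \<in> cost ` PA" using finPA by (intro Min_in) auto
  then obtain s where smin: "Min (cost ` PA) = cost s" and s: "s \<in> PA" by (rule imageE)
  have sle: "cost s \<le> cost p" if "p \<in> PA" for p
    unfolding smin[symmetric] using that finPA by simp
  \<comment> \<open>\<open>gcost p\<close> prices only the pairs of \<open>p\<close> inside \<open>A\<close>; a single pair
    outside then makes up for any saving.\<close>
  define K where "K = max 0 (cost s - Min (gcost ` P))"
  define d where "d i j = (if (i, j) \<in> A then c (i, j) else K)" for i j
  have K0: "0 \<le> K" unfolding K_def by simp
  have sA: "\<forall>i\<in>S. (i, s i) \<in> A" using s unfolding PA_def by blast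
  have sperm: "s permutes S" using s unfolding PA_def P_def by blast
  have ds: "(\<Sum>i\<in>S. d i (s i)) = cost s"
    unfolding cost_def d_def using sA by (intro sum.cong) auto
  have opt: "(\<Sum>i\<in>S. d i (s i)) \<le> (\<Sum>i\<in>S. d i (p i))" if p: "p permutes S" for p
  proof (cases "p \<in> PA")
    case True
    then have "(\<Sum>i\<in>S. d i (p i)) = cost p"
      unfolding cost_def d_def PA_def by (intro sum.cong) auto
    with sle[OF True] ds show ?thesis by simp
  next
    case False
    with p obtain i0 where i0: "i0 \<in> S" "(i0, p i0) \<notin> A" unfolding PA_def P_def by blast
    have "Min (gcost ` P) \<le> gcost p" using finP p unfolding P_def by (intro Min_le) auto
    then have "cost s \<le> gcost p + K" unfolding K_def by linarith
    \<comment> \<open>One missing pair, at \<open>i0\<close>, is charged; further ones only add nonnegative terms.\<close>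
    also have "gcost p + K = (\<Sum>i\<in>S. g (i, p i) + (if i = i0 then K else 0))"
      unfolding gcost_def using S i0 by (simp add: sum.distrib)
    also have "\<dots> \<le> (\<Sum>i\<in>S. d i (p i))"
      using i0 K0 by (intro sum_mono) (auto simp: g_def d_def)
    finally show ?thesis using ds by simp
  qed
  obtain u v where uv: "\<And>i j. i \<in> S \<Longrightarrow> j \<in> S \<Longrightarrow> u i + v j \<le> d i j"
    and sum: "sum u S + sum v S = (\<Sum>i\<in>S. d i (s i))"
    using assignment_duality[OF S sperm, of d] opt by metis
  show ?thesis
  proof (rule that[OF sperm sA])
    show "dual_feasible A c u v"
      unfolding dual_feasible_def
    proof
      fix e assume e: "e \<in> A"
      then have "fst e \<in> S" "snd e \<in> S" using A by auto
      from uv[OF this] show "u (fst e) + v (snd e) \<le> c e" using e by (simp add: d_def)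
    qed
    show "sum u S + sum v S = (\<Sum>i\<in>S. c (i, s i))"
      using sum ds unfolding cost_def by simp
  qed
qed

section \<open>Cycle covers as assignments\<close>

lemma sum_01_eq_1_unique:
  fixes x :: "'a \<Rightarrow> real"
  assumes "finite F" "\<And>e. e \<in> F \<Longrightarrow> x e \<in> {0, 1}" "sum x F = 1"
  shows "\<exists>!e. e \<in> F \<and> x e = 1"
proof -
  have "sum x F = (\<Sum>e\<in>F. if x e = 1 then 1 else 0)"
    using assms(2) by (intro sum.cong) auto
  also have "\<dots> = real (card {e \<in> F. x e = 1})"
    using assms(1) by (simp flip: sum.inter_filter)
  finally have "card {e \<in> F. x e = 1} = 1" using assms(3) by simp
  then obtain e where "{e \<in> F. x e = 1} = {e}" by (auto simp: card_1_singleton_iff)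
  then show ?thesis by (intro ex1I[of _ e]) blast+
qed

lemma sum_indicator_singleton:
  assumes "finite F" "{e \<in> F. P e} = {a}"
  shows "(\<Sum>e\<in>F. if P e then 1 else 0 :: real) = 1"
  using assms by (simp flip: sum.inter_filter)

context
  fixes n :: nat and A :: "arc set"
  assumes arcs: "A \<subseteq> {1..n} \<times> {1..n}"
begin

lemma finite_arcs: "finite A"
  using arcs by (rule finite_subset) simp

lemma finite_cycle_covers: "finite (cycle_covers n A)"
  by (rule finite_subset[of _ "A \<rightarrow>\<^sub>E {0, 1}"])
    (auto simp: cycle_covers_def finite_arcs intro!: finite_PiE)

lemma cycle_cover_01: "x \<in> cycle_covers n A \<Longrightarrow> e \<in> A \<Longrightarrow> x e \<in> {0, 1}"
  unfolding cycle_covers_def by blast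

text \<open>
  The degree constraints pick exactly one outgoing and one incoming arc at each node, so the
  successor map of a cover is a permutation.
\<close>
lemma cycle_cover_imp_permutation:
  assumes x: "x \<in> cycle_covers n A"
  obtains s where "s permutes {1..n}" "\<And>i. i \<in> {1..n} \<Longrightarrow> (i, s i) \<in> A"
proof -
  have out: "\<exists>!e. e \<in> arcs_out A i \<and> x e = 1" if "i \<in> {1..n}" for i
    by (rule sum_01_eq_1_unique)
      (use x that finite_arcs in \<open>auto simp: cycle_covers_def arcs_out_def\<close>)
  have inn: "\<exists>!e. e \<in> arcs_in A i \<and> x e = 1" if "i \<in> {1..n}" for i
    by (rule sum_01_eq_1_unique)
      (use x that finite_arcs in \<open>auto simp: cycle_covers_def arcs_in_def\<close>)
  have "\<exists>j. (i, j) \<in> A \<and> x (i, j) = 1" if "i \<in> {1..n}" for i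
    using out[OF that] unfolding arcs_out_def by auto
  then obtain t where t: "\<And>i. i \<in> {1..n} \<Longrightarrow> (i, t i) \<in> A \<and> x (i, t i) = 1"
    by metis
  have tS: "t i \<in> {1..n}" if "i \<in> {1..n}" for i using t[OF that] arcs by blast
  have "inj_on t {1..n}"
  proof (rule inj_onI)
    fix i k assume i: "i \<in> {1..n}" and k: "k \<in> {1..n}" and eq: "t i = t k"
    have "(i, t i) \<in> arcs_in A (t i) \<and> x (i, t i) = 1"
      "(k, t k) \<in> arcs_in A (t i) \<and> x (k, t k) = 1"
      using t[OF i] t[OF k] eq unfolding arcs_in_def by auto
    with inn[OF tS[OF i]] have "(i, t i) = (k, t k)" by blast
    then show "i = k" by simp
  qed
  moreover have "t ` {1..n} \<subseteq> {1..n}" using tS by blast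
  ultimately have bij: "bij_betw t {1..n} {1..n}"
    by (intro bij_betw_imageI endo_inj_surj) auto
  define s where "s i = (if i \<in> {1..n} then t i else i)" for i
  have "bij_betw s {1..n} {1..n}"
    using bij by (subst bij_betw_cong[of _ _ t]) (auto simp: s_def)
  then have "s permutes {1..n}" by (rule bij_imp_permutes) (auto simp: s_def)
  with t show ?thesis by (intro that[of s]) (auto simp: s_def)
qed

lemma permutation_imp_cycle_cover:
  assumes s: "s permutes {1..n}" and sA: "\<And>i. i \<in> {1..n} \<Longrightarrow> (i, s i) \<in> A"
  obtains x where "x \<in> cycle_covers n A" "\<And>c. dot A c x = (\<Sum>i\<in>{1..n}. c (i, s i))"
proof -
  define x :: "arc \<Rightarrow> real" where "x = (\<lambda>e\<in>A. if snd e = s (fst e) then 1 else 0)"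
  have out: "(\<Sum>e\<in>arcs_out A i. x e) = 1" if i: "i \<in> {1..n}" for i
  proof -
    have "(\<Sum>e\<in>arcs_out A i. x e) = (\<Sum>e\<in>arcs_out A i. if snd e = s (fst e) then 1 else 0)"
      by (intro sum.cong) (auto simp: x_def arcs_out_def)
    also have "\<dots> = 1"
      by (rule sum_indicator_singleton[of _ _ "(i, s i)"])
        (use sA[OF i] finite_arcs in \<open>auto simp: arcs_out_def\<close>)
    finally show ?thesis .
  qed
  have inn: "(\<Sum>e\<in>arcs_in A j. x e) = 1" if j: "j \<in> {1..n}" for j
  proof -
    obtain i where i: "i \<in> {1..n}" "j = s i" using j permutes_image[OF s] by blast
    have "(\<Sum>e\<in>arcs_in A j. x e) = (\<Sum>e\<in>arcs_in A j. if snd e = s (fst e) then 1 else 0)"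
      by (intro sum.cong) (auto simp: x_def arcs_in_def)
    also have "\<dots> = 1"
      by (rule sum_indicator_singleton[of _ _ "(i, s i)"])
        (use sA[OF i(1)] i(2) finite_arcs permutes_inj[OF s] in \<open>auto simp: arcs_in_def inj_eq\<close>)
    finally show ?thesis .
  qed
  have "x \<in> cycle_covers n A"
    unfolding cycle_covers_def using out inn by (auto simp: x_def)
  moreover have "dot A c x = (\<Sum>i\<in>{1..n}. c (i, s i))" for c
  proof -
    have "dot A c x = (\<Sum>e\<in>A. if snd e = s (fst e) then c e else 0)"
      unfolding dot_def by (intro sum.cong) (auto simp: x_def)
    also have "\<dots> = (\<Sum>e\<in>{e \<in> A. snd e = s (fst e)}. c e)"
      using finite_arcs by (simp flip: sum.inter_filter)
    also have "{e \<in> A. snd e = s (fst e)} = (\<lambda>i. (i, s i)) ` {1..n}"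
      using arcs sA by force
    also have "sum c \<dots> = (\<Sum>i\<in>{1..n}. c (i, s i))"
      by (subst sum.reindex) (auto intro: inj_onI)
    finally show ?thesis .
  qed
  ultimately show ?thesis by (rule that)
qed

text \<open>
  A cover contains one arc out of and one arc into each node, so a cost that is a sum of node
  potentials is the same on all covers.  This is the source of weak duality and of the
  linearizability of the matrices in \<open>S_GL A Q\<close>.
\<close>
lemma dot_node_potentials:
  assumes x: "x \<in> cycle_covers n A"
  shows "dot A (\<lambda>e. u (fst e) + v (snd e)) x = sum u {1..n} + sum v {1..n}"
proof -
  have "(\<Sum>e\<in>A. u (fst e) * x e) = (\<Sum>i\<in>{1..n}. \<Sum>e\<in>{e \<in> A. fst e = i}. u (fst e) * x e)"
    using arcs finite_arcs by (intro sum.group[symmetric]) auto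
  also have "\<dots> = (\<Sum>i\<in>{1..n}. u i * (\<Sum>e\<in>arcs_out A i. x e))"
    unfolding arcs_out_def sum_distrib_left by (intro sum.cong) auto
  also have "\<dots> = sum u {1..n}"
    using x by (intro sum.cong) (auto simp: cycle_covers_def)
  finally have 1: "(\<Sum>e\<in>A. u (fst e) * x e) = sum u {1..n}" .
  have "(\<Sum>e\<in>A. v (snd e) * x e) = (\<Sum>i\<in>{1..n}. \<Sum>e\<in>{e \<in> A. snd e = i}. v (snd e) * x e)"
    using arcs finite_arcs by (intro sum.group[symmetric]) auto
  also have "\<dots> = (\<Sum>i\<in>{1..n}. v i * (\<Sum>e\<in>arcs_in A i. x e))"
    unfolding arcs_in_def sum_distrib_left by (intro sum.cong) auto
  also have "\<dots> = sum v {1..n}"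
    using x by (intro sum.cong) (auto simp: cycle_covers_def)
  finally have 2: "(\<Sum>e\<in>A. v (snd e) * x e) = sum v {1..n}" .
  show ?thesis
    unfolding dot_def by (simp add: distrib_right sum.distrib 1 2)
qed

lemma dot_mono:
  assumes "x \<in> cycle_covers n A" "\<And>e. e \<in> A \<Longrightarrow> p e \<le> q e"
  shows "dot A p x \<le> dot A q x"
  unfolding dot_def
proof (rule sum_mono)
  fix e assume e: "e \<in> A"
  then have "0 \<le> x e" using cycle_cover_01[OF assms(1) e] by auto
  then show "p e * x e \<le> q e * x e" using assms(2)[OF e] by (rule mult_right_mono[rotated])
qed

lemma cycle_cover_duality:
  assumes "cycle_covers n A \<noteq> {}"
  obtains u v x where "x \<in> cycle_covers n A"
    and "dual_feasible A c u v" and "sum u {1..n} + sum v {1..n} = dot A c x"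
proof -
  obtain s0 where s0: "s0 permutes {1..n}" "\<And>i. i \<in> {1..n} \<Longrightarrow> (i, s0 i) \<in> A"
    using assms cycle_cover_imp_permutation by blast
  obtain s u v where s: "s permutes {1..n}" "\<forall>i\<in>{1..n}. (i, s i) \<in> A"
    and uv: "dual_feasible A c u v"
    and val: "sum u {1..n} + sum v {1..n} = (\<Sum>i\<in>{1..n}. c (i, s i))"
    by (rule sparse_assignment_duality[where c = c, OF finite_atLeastAtMost arcs s0])
  obtain x where x: "x \<in> cycle_covers n A" "\<And>c. dot A c x = (\<Sum>i\<in>{1..n}. c (i, s i))"
    using permutation_imp_cycle_cover[OF s(1) bspec[OF s(2)]] by blast
  show ?thesis
  proof (rule that[OF x(1) uv])
    show "sum u {1..n} + sum v {1..n} = dot A c x" using val x(2) by simp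
  qed
qed

section \<open>Linearizable rows\<close>

text \<open>
  The free diagonal term \<open>t\<close> is paid exactly once on the covers through \<open>e\<close>, so that
  such a row is constant on these covers, but in general not on all covers.
\<close>
lemma linearizable_row_constant:
  fixes B C :: "nat \<Rightarrow> real"
  assumes x: "x \<in> cycle_covers n A" and e: "e \<in> A" "x e = 1"
    and off: "\<And>f. f \<in> A \<Longrightarrow> e \<noteq> f \<Longrightarrow> q f = B (fst f) + C (snd f)"
    and diag: "q e = B (fst e) + C (snd e) + t"
  shows "dot A q x = sum B {1..n} + sum C {1..n} + t"
proof -
  have "dot A q x
      = (\<Sum>f\<in>A. (B (fst f) + C (snd f)) * x f + (if f = e then t * x f else 0))"
    unfolding dot_def using off diag by (intro sum.cong) (auto simp: algebra_simps)
  also have "\<dots> = dot A (\<lambda>f. B (fst f) + C (snd f)) x + t"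
    using finite_arcs e by (simp add: sum.distrib dot_def)
  finally show ?thesis using dot_node_potentials[OF x] by simp
qed

lemma gl_cost_le:
  assumes "x \<in> cycle_covers n A" "x e = 1"
  shows "gl_cost n A Q e \<le> dot A (Q e) x"
  using assms finite_cycle_covers unfolding gl_cost_def Let_def by auto

lemma gl_cost_attained:
  assumes "x \<in> cycle_covers n A" "x e = 1"
  obtains x' where "x' \<in> cycle_covers n A" "x' e = 1" "gl_cost n A Q e = dot A (Q e) x'"
proof -
  let ?X = "{x \<in> cycle_covers n A. x e = 1}"
  have ne: "?X \<noteq> {}" using assms by blast
  have "Min ((\<lambda>x. dot A (Q e) x) ` ?X) \<in> (\<lambda>x. dot A (Q e) x) ` ?X"
    using finite_cycle_covers ne by (intro Min_in) auto
  then obtain x' where "x' \<in> ?X" and "Min ((\<lambda>x. dot A (Q e) x) ` ?X) = dot A (Q e) x'"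
    by blast
  with ne show ?thesis by (intro that[of x']) (simp_all only: gl_cost_def Let_def if_False mem_Collect_eq)
qed

text \<open>
  The restriction to covers through \<open>e\<close> is imposed by a price: the cost of \<open>e\<close> is replaced
  by \<open>k\<close> in an assignment problem over all covers, and the change is undone afterwards by
  the free diagonal term \<open>t = Q e e - k\<close>.  The value of \<open>k\<close> is the one at which avoiding
  \<open>e\<close>, at cost at least \<open>m\<close>, cannot beat the best cover through \<open>e\<close>, at cost
  \<open>gl_cost n A Q e - Q e e + k = m\<close>.
\<close>
lemma optimal_linearizable_row:
  assumes e: "e \<in> A" and ne: "cycle_covers n A \<noteq> {}"
  obtains B C :: "nat \<Rightarrow> real" and t :: real
  where "\<And>f. f \<in> A \<Longrightarrow> e \<noteq> f \<Longrightarrow> B (fst f) + C (snd f) \<le> Q e f"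
    and "B (fst e) + C (snd e) + t \<le> Q e e"
    and "gl_cost n A Q e \<le> sum B {1..n} + sum C {1..n} + t"
proof -
  let ?X = "cycle_covers n A"
  let ?z = "gl_cost n A Q e"
  define c0 where "c0 f = (if f = e then 0 else Q e f)" for f
  define m where "m = Min (dot A c0 ` ?X)"
  define k where "k = m - ?z + Q e e"
  define c where "c f = (if f = e then k else Q e f)" for f
  obtain u v x where x: "x \<in> ?X"
    and uv: "dual_feasible A c u v"
    and val: "sum u {1..n} + sum v {1..n} = dot A c x"
    by (rule cycle_cover_duality[OF ne, of c])
  have m: "m \<le> dot A c0 x" unfolding m_def using x finite_cycle_covers by auto
  have split: "dot A (\<lambda>f. if f = e then a else Q e f) x = dot A c0 x + a * x e" for a
  proof -
    have "dot A (\<lambda>f. if f = e then a else Q e f) x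
        = (\<Sum>f\<in>A. c0 f * x f + (if f = e then a * x f else 0))"
      unfolding dot_def by (intro sum.cong) (auto simp: c0_def)
    also have "\<dots> = dot A c0 x + a * x e"
      using finite_arcs e by (simp add: sum.distrib dot_def)
    finally show ?thesis .
  qed
  have cx: "dot A c x = dot A c0 x + k * x e" unfolding c_def by (rule split)
  have "(\<lambda>f. if f = e then Q e e else Q e f) = Q e" by auto
  then have Qx: "dot A (Q e) x = dot A c0 x + Q e e * x e" using split[of "Q e e"] by simp
  have "?z \<le> dot A c x + (Q e e - k)"
  proof (cases "x e = 1")
    case True
    then show ?thesis using gl_cost_le[OF x True, of Q] cx Qx by simp
  next
    case False
    then have "x e = 0" using cycle_cover_01[OF x e] by simp
    then show ?thesis using cx m unfolding k_def by simp
  qed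
  show ?thesis
  proof (rule that[of u v "Q e e - k"])
    show "u (fst f) + v (snd f) \<le> Q e f" if "f \<in> A" "e \<noteq> f" for f
      using uv that unfolding dual_feasible_def c_def by force
    show "u (fst e) + v (snd e) + (Q e e - k) \<le> Q e e"
      using uv e unfolding dual_feasible_def c_def by force
    show "?z \<le> sum u {1..n} + sum v {1..n} + (Q e e - k)"
      using \<open>?z \<le> dot A c x + (Q e e - k)\<close> val by simp
  qed
qed

lemma quad_eq_sum_rows: "quad A Qh x = (\<Sum>e\<in>A. dot A (Qh e) x * x e)"
  unfolding quad_def dot_def sum_distrib_right by (intro sum.cong) (auto simp: mult_ac)

section \<open>The two bounds\<close>

lemma S_GL_quad_le:
  assumes Qh: "Qh \<in> S_GL A Q" and x: "x \<in> cycle_covers n A"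
  shows "quad A Qh x \<le> dot A (gl_cost n A Q) x"
  unfolding quad_eq_sum_rows dot_def[of A "gl_cost n A Q"]
proof (rule sum_mono)
  fix e assume e: "e \<in> A"
  obtain B C :: "arc \<Rightarrow> nat \<Rightarrow> real" and t
    where off: "\<And>e f. e \<in> A \<Longrightarrow> f \<in> A \<Longrightarrow> e \<noteq> f \<Longrightarrow> Qh e f = B e (fst f) + C e (snd f)"
      and diag: "\<And>e. e \<in> A \<Longrightarrow> Qh e e = B e (fst e) + C e (snd e) + t e"
      and le: "\<And>e f. e \<in> A \<Longrightarrow> f \<in> A \<Longrightarrow> Qh e f \<le> Q e f"
    using Qh unfolding S_GL_def by force
  show "dot A (Qh e) x * x e \<le> gl_cost n A Q e * x e"
  proof (cases "x e = 1")
    case True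
    obtain x' where x': "x' \<in> cycle_covers n A" "x' e = 1" "gl_cost n A Q e = dot A (Q e) x'"
      using gl_cost_attained[OF x True] .
    have "dot A (Qh e) x = sum (B e) {1..n} + sum (C e) {1..n} + t e"
      by (rule linearizable_row_constant[where q = "Qh e" and B = "B e" and C = "C e" and t = "t e", OF x e True off[OF e] diag[OF e]])
    also have "\<dots> = dot A (Qh e) x'"
      by (rule linearizable_row_constant[where q = "Qh e" and B = "B e" and C = "C e" and t = "t e", OF x'(1) e x'(2) off[OF e] diag[OF e], symmetric])
    also have "\<dots> \<le> dot A (Q e) x'"
      by (rule dot_mono[OF x'(1) le[OF e]])
    finally show ?thesis using x'(3) True by simp
  next
    case False
    then show ?thesis using cycle_cover_01[OF x e] by simp
  qed
qed

text \<open>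
  Rows that attain the Gilmore-Lawler costs together form a matrix of \<open>S_GL A Q\<close> whose quadratic
  form equals the linear form of \<open>gl_cost n A Q\<close> on every cover.
\<close>
lemma gl_cost_in_tau_GL:
  assumes ne: "cycle_covers n A \<noteq> {}"
  shows "gl_cost n A Q \<in> tau_GL n A Q"
proof -
  have "\<exists>(B :: nat \<Rightarrow> real) C t. (\<forall>f\<in>A. e \<noteq> f \<longrightarrow> B (fst f) + C (snd f) \<le> Q e f) \<and>
      B (fst e) + C (snd e) + t \<le> Q e e \<and>
      gl_cost n A Q e \<le> sum B {1..n} + sum C {1..n} + t" if "e \<in> A" for e
    by (rule optimal_linearizable_row[OF that ne, of Q]) blast
  then obtain B C :: "arc \<Rightarrow> nat \<Rightarrow> real" and t
    where off: "\<And>e f. e \<in> A \<Longrightarrow> f \<in> A \<Longrightarrow> e \<noteq> f \<Longrightarrow> B e (fst f) + C e (snd f) \<le> Q e f"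
      and diag: "\<And>e. e \<in> A \<Longrightarrow> B e (fst e) + C e (snd e) + t e \<le> Q e e"
      and val: "\<And>e. e \<in> A \<Longrightarrow> gl_cost n A Q e \<le> sum (B e) {1..n} + sum (C e) {1..n} + t e"
    by metis
  define Qh where "Qh e f = B e (fst f) + C e (snd f) + (if e = f then t e else 0)" for e f
  have S: "Qh \<in> S_GL A Q"
    unfolding S_GL_def
    by (rule CollectI, intro conjI exI[of _ B] exI[of _ C] exI[of _ t])
      (use off diag in \<open>auto simp: Qh_def\<close>)
  have "dot A (gl_cost n A Q) x = quad A Qh x" if x: "x \<in> cycle_covers n A" for x
  proof (rule antisym)
    show "quad A Qh x \<le> dot A (gl_cost n A Q) x" by (rule S_GL_quad_le[OF S x])
    show "dot A (gl_cost n A Q) x \<le> quad A Qh x"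
      unfolding quad_eq_sum_rows dot_def[of A "gl_cost n A Q"]
    proof (rule sum_mono)
      fix e assume e: "e \<in> A"
      show "gl_cost n A Q e * x e \<le> dot A (Qh e) x * x e"
      proof (cases "x e = 1")
        case True
        have "dot A (Qh e) x = sum (B e) {1..n} + sum (C e) {1..n} + t e"
          by (rule linearizable_row_constant[where q = "Qh e" and B = "B e" and C = "C e" and t = "t e", OF x e True]) (auto simp: Qh_def)
        then show ?thesis using val[OF e] True by simp
      next
        case False
        then show ?thesis using cycle_cover_01[OF x e] by simp
      qed
    qed
  qed
  then show ?thesis using S unfolding tau_GL_def by blast
qed

text \<open>
  The vector \<open>y\<close> splits into tail potentials \<open>u i = y i\<close> and head potentials
  \<open>v i = y (n + i)\<close>, which exhibits the linearization bound as an assignment dual with a variable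
  right-hand side.
\<close>
lemma lbb_values_iff:
  "a \<in> lbb_values n A Q \<longleftrightarrow>
    (\<exists>u v. a = sum u {1..n} + sum v {1..n} \<and>
      (\<exists>p\<in>tau_GL n A Q. dual_feasible A p u v))"
proof -
  have row: "(\<Sum>i\<in>{1..n}. U_mat i e * y i) + (\<Sum>i\<in>{1..n}. V_mat i e * y (n + i))
      = y (fst e) + y (n + snd e)" if "e \<in> A" for y e
  proof -
    have "fst e \<in> {1..n}" "snd e \<in> {1..n}" using arcs that by auto
    then show ?thesis
      by (simp add: U_mat_def V_mat_def if_distrib[of "\<lambda>a. a * _"] cong: if_cong)
  qed
  have total: "(\<Sum>i\<in>{1..2 * n}. y i) = sum y {1..n} + (\<Sum>i\<in>{1..n}. y (n + i))"
    for y :: "nat \<Rightarrow> real"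
  proof -
    have "(\<Sum>i\<in>{1..n + n}. y i) = sum y {1..n} + sum y {n + 1..n + n}"
      by (rule sum.ub_add_nat) simp
    also have "sum y {n + 1..n + n} = (\<Sum>i\<in>{1..n}. y (n + i))"
      using sum.shift_bounds_cl_nat_ivl[of y 1 n n] by (simp add: add.commute)
    finally show ?thesis by (simp add: mult_2)
  qed
  show ?thesis
  proof
    assume "a \<in> lbb_values n A Q"
    then obtain y p where "a = (\<Sum>i\<in>{1..2 * n}. y i)" "p \<in> tau_GL n A Q"
      "\<forall>e\<in>A. (\<Sum>i\<in>{1..n}. U_mat i e * y i) + (\<Sum>i\<in>{1..n}. V_mat i e * y (n + i)) \<le> p e"
      unfolding lbb_values_def by blast
    then have "a = sum y {1..n} + (\<Sum>i\<in>{1..n}. y (n + i)) \<and>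
        dual_feasible A p y (\<lambda>i. y (n + i)) \<and> p \<in> tau_GL n A Q"
      unfolding total by (simp add: row dual_feasible_def del: One_nat_def)
    then show "\<exists>u v. a = sum u {1..n} + sum v {1..n} \<and>
      (\<exists>p\<in>tau_GL n A Q. dual_feasible A p u v)"
      by - (rule exI[of _ y], rule exI[of _ "\<lambda>i. y (n + i)"], blast)
  next
    assume "\<exists>u v. a = sum u {1..n} + sum v {1..n} \<and>
      (\<exists>p\<in>tau_GL n A Q. dual_feasible A p u v)"
    then obtain u v p where a: "a = sum u {1..n} + sum v {1..n}" and p: "p \<in> tau_GL n A Q"
      and le: "dual_feasible A p u v" by blast
    define y where "y i = (if i \<le> n then u i else v (i - n))" for i
    have "y (fst e) + y (n + snd e) = u (fst e) + v (snd e)" if "e \<in> A" for e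
      using arcs that by (auto simp: y_def)
    moreover have "a = (\<Sum>i\<in>{1..2 * n}. y i)"
      unfolding total a by (intro arg_cong2[of _ _ _ _ plus] sum.cong) (auto simp: y_def)
    ultimately show "a \<in> lbb_values n A Q"
      using p le unfolding lbb_values_def dual_feasible_def
      by (intro CollectI exI[of _ y] exI[of _ p]) (simp add: row del: One_nat_def)
  qed
qed

text \<open>
  Without covers, all that remains of the condition defining \<open>tau_GL n A Q\<close> is that
  \<open>S_GL A Q\<close> be nonempty, which a sufficiently negative constant matrix shows.  Each value is then
  reached by spreading it evenly over the tail potentials; there is at least one node, since the
  empty graph has the empty cover.
\<close>
lemma lbb_unbounded:
  assumes empty: "cycle_covers n A = {}"
  shows "lbb_values n A Q = UNIV"
proof -
  have n: "n \<noteq> 0"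
  proof
    assume "n = 0"
    then have "(\<lambda>_. undefined) \<in> cycle_covers n A"
      using arcs unfolding cycle_covers_def by auto
    with empty show False by blast
  qed
  define L where "L = (\<Sum>e\<in>A. \<Sum>f\<in>A. \<bar>Q e f\<bar>)"
  have "- L \<le> Q e f" if "e \<in> A" "f \<in> A" for e f
  proof -
    have "\<bar>Q e f\<bar> \<le> (\<Sum>f\<in>A. \<bar>Q e f\<bar>)"
      using that finite_arcs by (intro member_le_sum) auto
    also have "\<dots> \<le> L"
      unfolding L_def using that finite_arcs
      by (intro member_le_sum[of e A "\<lambda>e. \<Sum>f\<in>A. \<bar>Q e f\<bar>"]) (auto intro: sum_nonneg)
    finally show ?thesis by linarith
  qed
  then have "\<forall>e\<in>A. \<forall>f\<in>A. 0 \<le> Q e f - (- L)" by force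
  then have "(\<lambda>_ _. - L) \<in> S_GL A Q"
    unfolding S_GL_def
    by - (rule CollectI, rule conjI, assumption, rule exI[of _ "\<lambda>_ _. - L"],
        rule exI[of _ "\<lambda>_ _. 0"], rule exI[of _ "\<lambda>_. 0"], simp)
  then have tau: "p \<in> tau_GL n A Q" for p
    unfolding tau_GL_def using empty by blast
  show ?thesis
  proof (rule UNIV_eq_I[symmetric])
    fix a
    show "a \<in> lbb_values n A Q"
      unfolding lbb_values_iff using n tau[of "\<lambda>_. a / n"]
      by - (rule exI[of _ "\<lambda>_. a / n"], rule exI[of _ "\<lambda>_. 0"],
        auto simp: dual_feasible_def)
  qed
qed

lemma lbb_maximum:
  fixes Q :: "arc \<Rightarrow> arc \<Rightarrow> real"
  assumes ne: "cycle_covers n A \<noteq> {}"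
  defines "m \<equiv> Min (dot A (gl_cost n A Q) ` cycle_covers n A)"
  shows "m \<in> lbb_values n A Q" and "\<And>a. a \<in> lbb_values n A Q \<Longrightarrow> a \<le> m"
proof -
  let ?z = "gl_cost n A Q"
  have "m \<in> dot A ?z ` cycle_covers n A"
    unfolding m_def using ne finite_cycle_covers by (intro Min_in) auto
  then obtain x where x: "x \<in> cycle_covers n A" and mx: "m = dot A ?z x" by blast
  show le: "a \<le> m" if a_mem: "a \<in> lbb_values n A Q" for a
  proof -
    obtain u v p where a: "a = sum u {1..n} + sum v {1..n}" and p: "p \<in> tau_GL n A Q"
      and uv: "dual_feasible A p u v"
      using a_mem unfolding lbb_values_iff by blast
    obtain Qh where Qh: "Qh \<in> S_GL A Q" and eq: "dot A p x = quad A Qh x"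
      using p x unfolding tau_GL_def by blast
    have "a = dot A (\<lambda>e. u (fst e) + v (snd e)) x"
      unfolding a by (rule dot_node_potentials[OF x, symmetric])
    also have "\<dots> \<le> dot A p x" 
      by (rule dot_mono[OF x]) (use uv in \<open>auto simp: dual_feasible_def\<close>)
    also have "\<dots> \<le> m" unfolding eq mx by (rule S_GL_quad_le[OF Qh x])
    finally show ?thesis .
  qed
  obtain u v x' where x': "x' \<in> cycle_covers n A"
    and uv: "dual_feasible A ?z u v"
    and val: "sum u {1..n} + sum v {1..n} = dot A ?z x'"
    by (rule cycle_cover_duality[OF ne, of ?z])
  have mem: "dot A ?z x' \<in> lbb_values n A Q"
    unfolding lbb_values_iff using uv val gl_cost_in_tau_GL[OF ne, of Q] by metis
  moreover have "m \<le> dot A ?z x'"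
    unfolding m_def using x' finite_cycle_covers by auto
  ultimately show "m \<in> lbb_values n A Q" using le by force
qed

end

theorem theorem4:
  fixes n :: nat
    and A :: "arc set"
    and Q :: "arc \<Rightarrow> arc \<Rightarrow> real"
  assumes "qccp_instance n A Q"
  shows "v_LBB_GL n A Q = v_GL n A Q"
proof -
  have arcs: "A \<subseteq> {1..n} \<times> {1..n}" using assms unfolding qccp_instance_def by blast
  show ?thesis
  proof (cases "cycle_covers n A = {}")
    case True
    have "\<not> bdd_above (UNIV :: real set)"
      by (metis UNIV_I bdd_above.unfold gt_ex not_le)
    with True show ?thesis
      unfolding v_LBB_GL_def v_GL_def max_value_def lbb_unbounded[OF arcs True] by simp
  next
    case False
    let ?m = "Min (dot A (gl_cost n A Q) ` cycle_covers n A)"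
    note max = lbb_maximum[OF arcs False, where Q = Q]
    have "(GREATEST v. v \<in> lbb_values n A Q) = ?m"
      by (rule Greatest_equality) (use max in auto)
    moreover have "bdd_above (lbb_values n A Q)" using max(2) by (rule bdd_aboveI)
    ultimately show ?thesis
      using False max(1) unfolding v_LBB_GL_def v_GL_def max_value_def by auto
  qed
qed

end
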